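(* Let $p$ be a prime and let $d$ be an integer with $(d,p)=1$. Define \[ S_3(d)=\mathop{\sum_{a=1}^{p-1}\sum_{b=1}^{p-1}\sum_{c=1}^{p-1}}_{abc\equiv d\pmod p} abc. \] Then \[ S_3(d)=\frac{p^5}{8}+O\bigl(p^{9/2}(\log p)^2\bigr), \] where the implied constant is absolute.
   Context: $f=O(g)$ means $|f|\le Cg$ for some constant $C>0$. *)

theory Defs
  imports Complex_Main "HOL-Number_Theory.Cong" "HOL-Computational_Algebra.Primes"
begin

definition S3 :: "nat \<Rightarrow> int \<Rightarrow> nat" where
  "S3 p d = (\<Sum>(a, b, c) \<in> {(a, b, c). a \<in> {1..p-1} \<and> b \<in> {1..p-1} \<and> c \<in> {1..p-1}
                                    \<and> [int (a * b * c) = d] (mod int p)}. a * b * c)"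

end

theory Submission
  imports Defs "HOL-Analysis.Harmonic_Numbers" "HOL-Analysis.Convex"
begin

text \<open>
  Given \<open>a\<close> and \<open>b\<close>, the third variable is the residue \<open>c\<close> of \<open>d a\<^sup>-\<^sup>1 b\<^sup>-\<^sup>1\<close>. Writing
  \<open>c = p/2 + (c - p/2)\<close>, the constant \<open>p/2\<close> contributes \<open>p\<^sup>3 (p - 1)\<^sup>2 / 8\<close>. The function
  \<open>c - p/2\<close> (extended by \<open>0\<close> at \<open>c = 0\<close>) has mean zero, and its additive Fourier coefficients
  modulo \<open>p\<close> have absolute sum \<open>O(p\<^sup>2 log p)\<close>. For each frequency \<open>h \<noteq> 0\<close> the remaining sum is
  a bilinear form in \<open>a\<close> and \<open>b\<close> with kernel \<open>e(h d a\<^sup>-\<^sup>1 b\<^sup>-\<^sup>1 / p)\<close>, whose operator norm is at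
  most \<open>\<surd>p\<close> by Cauchy-Schwarz and Parseval. The error is thus \<open>O(p\<^bsup>9/2\<^esup> log p)\<close>; no
  multiplicative characters or Kloosterman sum bounds are needed.
\<close>

section \<open>Additive characters modulo \<open>p\<close>\<close>

definition add_char :: "nat \<Rightarrow> int \<Rightarrow> complex" where
  "add_char p k = cis (2 * pi * of_int k / of_nat p)"

lemma add_char_add: "add_char p (k + l) = add_char p k * add_char p l"
  by (simp add: add_char_def cis_mult add_divide_distrib distrib_left)

lemma add_char_0 [simp]: "add_char p 0 = 1"
  by (simp add: add_char_def)

lemma norm_add_char [simp]: "norm (add_char p k) = 1"
  by (simp add: add_char_def)

lemma cnj_add_char: "cnj (add_char p k) = add_char p (- k)"
  by (simp add: add_char_def cis_cnj)

lemma add_char_mult_nat: "add_char p (k * int n) = add_char p k ^ n"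
  by (induction n) (simp_all add: add_char_add distrib_left)

lemma add_char_multiple:
  assumes "p > 0"
  shows "add_char p (int p * k) = 1"
proof -
  have "2 * pi * of_int (int p * k) / of_nat p = 2 * pi * of_int k"
    using assms by simp
  then show ?thesis by (simp only: add_char_def cis_multiple_2pi Ints_of_int)
qed

lemma add_char_mod:
  assumes "p > 0"
  shows "add_char p (k mod int p) = add_char p k"
proof -
  have "add_char p k = add_char p (int p * (k div int p) + k mod int p)"
    by simp
  also have "\<dots> = add_char p (k mod int p)"
    by (simp only: add_char_add add_char_multiple[OF assms]) simp
  finally show ?thesis by simp
qed

lemma norm_cis_minus_1: "norm (cis (2 * x) - 1) = 2 * \<bar>sin x\<bar>"
proof -
  have "cis (2 * x) - 1 = cis x * (cis x - cis (- x))"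
    by (simp add: right_diff_distrib cis_mult)
  also have "cis x - cis (- x) = 2 * \<i> * of_real (sin x)"
    by (simp add: complex_eq_iff)
  finally show ?thesis by (simp add: norm_mult)
qed

text \<open>Jordan's inequality: sine is concave on the interval from 0 to pi/2, so it lies above
  its chord. Convexity of the negated sine is applied with weight \<open>2 / pi * x\<close>.\<close>

lemma two_over_pi_mult_le_sin:
  fixes x :: real
  assumes "0 \<le> x" "x \<le> pi / 2"
  shows "2 / pi * x \<le> sin x"
proof -
  have "convex_on {0..pi/2} (\<lambda>x::real. - sin x)"
  proof (rule f''_ge0_imp_convex[where f' = "\<lambda>x. - cos x" and f'' = sin])
    fix x :: real assume "x \<in> {0..pi/2}"
    then show "sin x \<ge> 0" by (intro sin_ge_zero) auto
  qed (auto intro!: derivative_eq_intros)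
  from convex_onD[OF this, of "2 / pi * x" 0 "pi / 2"] show ?thesis
    using assms by (simp add: field_simps)
qed

text \<open>The norm is twice the absolute value of sin(pi h / p). Reflecting h to p - h keeps the
  sine and brings the angle into the range of Jordan's inequality. This bounds from below the
  denominators of the geometric sums to come.\<close>

lemma norm_add_char_minus_1_ge:
  assumes "0 < h" "h < p"
  shows "4 * real (min h (p - h)) / real p \<le> norm (add_char p (int h) - 1)"
proof -
  define m where "m = min h (p - h)"
  have "sin (pi * real h / real p) = sin (pi * real m / real p)"
  proof (cases "m = h")
    case False
    then have "m = p - h" by (auto simp: m_def min_def split: if_splits)
    then have "pi * real m / real p = pi - pi * real h / real p"
      using assms by (simp add: field_simps of_nat_diff)
    then show ?thesis by simp
  qed simp
  moreover have "2 / pi * (pi * real m / real p) \<le> sin (pi * real m / real p)"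
  proof (rule two_over_pi_mult_le_sin)
    have "2 * m \<le> p" by (auto simp: m_def)
    then have "2 * real m \<le> real p" by linarith
    then show "pi * real m / real p \<le> pi / 2"
      using assms by (simp add: field_simps)
  qed simp
  moreover have "norm (add_char p (int h) - 1) = 2 * \<bar>sin (pi * real h / real p)\<bar>"
    using norm_cis_minus_1[of "pi * real h / real p"] by (simp add: add_char_def mult.assoc)
  moreover have "2 / pi * (pi * real m / real p) = 2 * real m / real p" by simp
  ultimately have "2 * (2 * real m / real p) \<le> norm (add_char p (int h) - 1)" by linarith
  then show ?thesis by (simp add: m_def)
qed

lemma add_char_eq_1_iff:
  assumes "p > 0"
  shows "add_char p k = 1 \<longleftrightarrow> int p dvd k"
proof
  assume "add_char p k = 1"
  define h where "h = nat (k mod int p)"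
  have h: "int h = k mod int p" "h < p" using assms by (auto simp: h_def nat_less_iff)
  have "add_char p (int h) = 1"
    using \<open>add_char p k = 1\<close> h add_char_mod[OF assms] by simp
  \<comment> \<open>For 0 < h < p the lower bound just proved is strictly positive, so the character
    value cannot be 1.\<close>
  then have "h = 0"
    using norm_add_char_minus_1_ge[of h p] h(2) assms by (cases "h = 0") (auto simp: field_simps)
  then show "int p dvd k" using h by (simp add: dvd_eq_mod_eq_0)
qed (auto simp: add_char_multiple assms)

lemma add_char_power_modulus: "p > 0 \<Longrightarrow> add_char p k ^ p = 1"
  using add_char_multiple[of p k] add_char_mult_nat[of p k p] by (simp add: mult.commute)

lemma sum_add_char:
  assumes "p > 0"
  shows "(\<Sum>x<p. add_char p (k * int x)) = (if int p dvd k then of_nat p else 0)"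
proof (cases "int p dvd k")
  case True
  then have "add_char p k = 1" using add_char_eq_1_iff[OF assms] by simp
  then show ?thesis using True by (simp add: add_char_mult_nat)
next
  case False
  then have "add_char p k \<noteq> 1" using add_char_eq_1_iff[OF assms] by simp
  then show ?thesis using False assms
    by (simp add: add_char_mult_nat sum_gp_strict add_char_power_modulus)
qed

section \<open>Parseval and the operator norm of the bilinear form\<close>

text \<open>Parseval: after expanding the square, only the diagonal survives the sum over x, because
  \<open>k\<close> is invertible modulo \<open>p\<close> and the frequencies \<open>y b\<close> are
  distinct residues. In the application \<open>y\<close> sends a residue to its inverse.\<close>

lemma sum_norm_add_char_transform:
  fixes v :: "'a \<Rightarrow> real" and y :: "'a \<Rightarrow> nat"
  assumes "prime p" "\<not> int p dvd k" "finite B" "inj_on y B" "y ` B \<subseteq> {..<p}"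
  shows "(\<Sum>x<p. (norm (\<Sum>b\<in>B. of_real (v b) * add_char p (k * int x * int (y b))))\<^sup>2)
           = real p * (\<Sum>b\<in>B. (v b)\<^sup>2)"
proof -
  have p: "p > 0" using assms(1) prime_gt_0_nat by blast
  have ortho: "(\<Sum>x<p. add_char p (k * (int (y b) - int (y c)) * int x)) = (if b = c then of_nat p else 0)"
    if "b \<in> B" "c \<in> B" for b c
  proof -
    have "int p dvd k * (int (y b) - int (y c)) \<longleftrightarrow> int p dvd int (y b) - int (y c)"
      using assms(1,2) by (simp add: prime_dvd_mult_iff)
    also have "\<dots> \<longleftrightarrow> int (y b) mod int p = int (y c) mod int p"
      by (simp add: mod_eq_dvd_iff)
    also have "\<dots> \<longleftrightarrow> y b = y c"
    proof -
      have "y b < p" "y c < p" using assms(5) that by auto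
      then show ?thesis by simp
    qed
    also have "\<dots> \<longleftrightarrow> b = c" using assms(4) that by (auto dest: inj_onD)
    finally show ?thesis using sum_add_char[OF p] by simp
  qed
  have "complex_of_real (\<Sum>x<p. (norm (\<Sum>b\<in>B. of_real (v b) * add_char p (k * int x * int (y b))))\<^sup>2)
      = (\<Sum>x<p. \<Sum>b\<in>B. \<Sum>c\<in>B. of_real (v b * v c) * add_char p (k * (int (y b) - int (y c)) * int x))"
    unfolding of_real_sum complex_norm_square cnj_sum sum_product
  proof (intro sum.cong refl)
    fix x b c
    have "k * (int (y b) - int (y c)) * int x = k * int x * int (y b) + - (k * int x * int (y c))"
      by (simp add: algebra_simps)
    then have "add_char p (k * (int (y b) - int (y c)) * int x)
        = add_char p (k * int x * int (y b)) * cnj (add_char p (k * int x * int (y c)))"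
      by (simp only: add_char_add cnj_add_char)
    then show "of_real (v b) * add_char p (k * int x * int (y b))
          * cnj (of_real (v c) * add_char p (k * int x * int (y c)))
        = of_real (v b * v c) * add_char p (k * (int (y b) - int (y c)) * int x)"
      by simp
  qed
  also have "\<dots> = (\<Sum>b\<in>B. \<Sum>c\<in>B. of_real (v b * v c) * (\<Sum>x<p. add_char p (k * (int (y b) - int (y c)) * int x)))"
    by (subst sum.swap, rule sum.cong[OF refl], subst sum.swap) (simp add: sum_distrib_left)
  also have "\<dots> = (\<Sum>b\<in>B. \<Sum>c\<in>B. of_real (v b * v c) * (if b = c then of_nat p else 0))"
    by (intro sum.cong refl) (simp add: ortho)
  also have "\<dots> = (\<Sum>b\<in>B. of_real (v b * v b) * of_nat p)"
    using assms(3) by (simp add: if_distrib cong: if_cong)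
  also have "\<dots> = complex_of_real (real p * (\<Sum>b\<in>B. (v b)\<^sup>2))"
    by (simp add: sum_distrib_left power2_eq_square mult_ac)
  finally show ?thesis by (simp only: of_real_eq_iff)
qed

text \<open>Cauchy-Schwarz in \<open>a\<close> leaves the mean square of the inner sum over the
  points \<open>y a\<close>. These are distinct residues, so by positivity the sum extends to all x
  below \<open>p\<close>, where Parseval is exact.\<close>

lemma norm_bilinear_add_char_sum_le:
  fixes u v :: "'a \<Rightarrow> real" and y :: "'a \<Rightarrow> nat"
  assumes "prime p" "\<not> int p dvd k" "finite B" "inj_on y B" "y ` B \<subseteq> {..<p}"
  shows "norm (\<Sum>a\<in>B. \<Sum>b\<in>B. of_real (u a * v b) * add_char p (k * int (y a) * int (y b)))
           \<le> sqrt (real p) * sqrt (\<Sum>a\<in>B. (u a)\<^sup>2) * sqrt (\<Sum>b\<in>B. (v b)\<^sup>2)"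
proof -
  define V where "V x = (\<Sum>b\<in>B. of_real (v b) * add_char p (k * int x * int (y b)))" for x
  have "(\<Sum>a\<in>B. (norm (V (y a)))\<^sup>2) = (\<Sum>x\<in>y ` B. (norm (V x))\<^sup>2)"
    by (simp add: sum.reindex[OF assms(4)])
  also have "\<dots> \<le> (\<Sum>x<p. (norm (V x))\<^sup>2)"
    by (rule sum_mono2) (use assms(5) in auto)
  also have "\<dots> = real p * (\<Sum>b\<in>B. (v b)\<^sup>2)"
    unfolding V_def by (rule sum_norm_add_char_transform) fact+
  finally have V: "(\<Sum>a\<in>B. (norm (V (y a)))\<^sup>2) \<le> real p * (\<Sum>b\<in>B. (v b)\<^sup>2)" .
  have "(\<Sum>a\<in>B. \<Sum>b\<in>B. of_real (u a * v b) * add_char p (k * int (y a) * int (y b)))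
      = (\<Sum>a\<in>B. of_real (u a) * V (y a))"
    by (simp add: V_def sum_distrib_left mult_ac)
  also have "norm \<dots> \<le> (\<Sum>a\<in>B. \<bar>u a\<bar> * norm (V (y a)))"
    by (rule norm_sum[THEN order_trans]) (simp add: norm_mult)
  also have "\<dots> \<le> sqrt ((\<Sum>a\<in>B. (u a)\<^sup>2) * (\<Sum>a\<in>B. (norm (V (y a)))\<^sup>2))"
    using Cauchy_Schwarz_ineq_sum[of "\<lambda>a. \<bar>u a\<bar>" "\<lambda>a. norm (V (y a))" B]
    by (intro real_le_rsqrt) simp
  also have "\<dots> \<le> sqrt ((\<Sum>a\<in>B. (u a)\<^sup>2) * (real p * (\<Sum>b\<in>B. (v b)\<^sup>2)))"
    by (intro real_sqrt_le_mono mult_left_mono V sum_nonneg) auto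
  finally show ?thesis by (simp add: real_sqrt_mult mult_ac)
qed

section \<open>The sawtooth function and its Fourier coefficients\<close>

text \<open>With the value 0 at 0, the terms at n and p - n cancel, so the zero frequency
  vanishes.\<close>

definition sawtooth :: "nat \<Rightarrow> nat \<Rightarrow> real" where
  "sawtooth p n = (if n = 0 then 0 else real n - real p / 2)"

text \<open>Unnormalised discrete Fourier transform; the factor \<open>p\<close> appears in the
  inversion formula \<open>sawtooth_expansion\<close> instead.\<close>

definition sawtooth_transform :: "nat \<Rightarrow> nat \<Rightarrow> complex" where
  "sawtooth_transform p h = (\<Sum>n<p. of_real (sawtooth p n) * add_char p (- int h * int n))"

lemma sum_sawtooth_mult:
  fixes g :: "nat \<Rightarrow> complex"
  assumes "p > 0"
  shows "(\<Sum>n<p. of_real (sawtooth p n) * g n)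
           = (\<Sum>n<p. of_nat n * g n) - of_nat p / 2 * ((\<Sum>n<p. g n) - g 0)"
proof -
  have "(\<Sum>n<p. of_real (sawtooth p n) * g n)
      = (\<Sum>n<p. of_nat n * g n - of_nat p / 2 * (g n - (if n = 0 then g n else 0)))"
    by (intro sum.cong) (auto simp: sawtooth_def algebra_simps)
  also have "\<dots> = (\<Sum>n<p. of_nat n * g n) - of_nat p / 2 * ((\<Sum>n<p. g n) - g 0)"
    using assms by (simp only: sum_subtractf sum_distrib_left[symmetric]) simp
  finally show ?thesis .
qed

lemma sum_real_lessThan: "(\<Sum>n<p. real n) = real p * (real p - 1) / 2"
  by (induction p) (simp_all add: field_simps)

lemma sawtooth_transform_0:
  assumes "p > 0"
  shows "sawtooth_transform p 0 = 0"
proof -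
  have "(\<Sum>n<p. complex_of_nat n) = of_real (real p * (real p - 1) / 2)"
    by (subst sum_real_lessThan[symmetric]) simp
  then show ?thesis
    using sum_sawtooth_mult[OF assms, of "\<lambda>_. 1"] by (simp add: sawtooth_transform_def)
qed

text \<open>A division-free form of the differentiated geometric sum. At a p-th root of unity z
  other than 1 it makes the weighted sum equal to p / (z - 1).\<close>

lemma sum_of_nat_mult_power:
  fixes z :: "'a :: comm_ring_1"
  shows "(z - 1) * (\<Sum>n<p. of_nat n * z ^ n) = of_nat p * z ^ p - z * (\<Sum>n<p. z ^ n)"
  by (induction p) (simp_all add: algebra_simps)

text \<open>The coefficient is p / (z - 1) + p / 2 for a root of unity z, and the norm of z - 1 is
  at least 4 m / p with m the smaller of h and p - h. Bounding 1 / m by the sum of both reciprocals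
  gives a form that sums to harmonic numbers.\<close>

lemma norm_sawtooth_transform_le:
  assumes "0 < h" "h < p"
  shows "norm (sawtooth_transform p h) \<le> (real p)\<^sup>2 / 2 * (1 / real h + 1 / real (p - h))"
proof -
  have p: "p > 0" using assms by simp
  define z where "z = add_char p (- int h)"
  define t where "t = norm (z - 1)"
  define m where "m = min h (p - h)"
  have m: "m > 0" using assms by (simp add: m_def)
  have "t = norm (add_char p (int h) - 1)"
    unfolding t_def z_def cnj_add_char[symmetric]
    by (metis complex_cnj_diff complex_cnj_one complex_mod_cnj)
  then have t: "4 * real m / real p \<le> t"
    using norm_add_char_minus_1_ge[OF assms] by (simp add: m_def)
  then have t0: "t > 0" using m p by (smt (verit) divide_pos_pos of_nat_0_less_iff)
  then have z1: "z \<noteq> 1" by (auto simp: t_def)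
  have zp: "z ^ p = 1" using add_char_power_modulus[OF p] by (simp add: z_def)
  have gp: "(\<Sum>n<p. z ^ n) = 0" using z1 zp by (simp add: sum_gp_strict)
  have "(\<Sum>n<p. of_nat n * z ^ n) = of_nat p / (z - 1)"
    using sum_of_nat_mult_power[of z p] z1 by (simp add: gp zp field_simps)
  then have "sawtooth_transform p h = of_nat p / (z - 1) + of_nat p / 2"
    using sum_sawtooth_mult[OF p, of "\<lambda>n. z ^ n"] gp
    by (simp add: sawtooth_transform_def z_def add_char_mult_nat del: mult_minus_left)
  also have "norm \<dots> \<le> real p / t + real p / 2"
    by (rule norm_triangle_ineq[THEN order_trans]) (simp add: norm_divide t_def)
  \<comment> \<open>The summand p / 2 is at most p / t, since two points of the unit circle are at
    distance at most 2.\<close>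
  also have "\<dots> \<le> 2 * real p / t"
  proof -
    have "t \<le> 2"
      using norm_triangle_ineq4[of z 1] by (simp add: t_def z_def)
    then have "real p / 2 \<le> real p / t" using t0 by (intro divide_left_mono) auto
    then show ?thesis by simp
  qed
  also have "\<dots> \<le> 2 * real p / (4 * real m / real p)"
    using t t0 m p by (intro divide_left_mono) auto
  also have "\<dots> = (real p)\<^sup>2 / 2 * (1 / real m)"
    using m p by (simp add: field_simps power2_eq_square)
  also have "\<dots> \<le> (real p)\<^sup>2 / 2 * (1 / real h + 1 / real (p - h))"
    by (intro mult_left_mono) (auto simp: m_def min_def)
  finally show ?thesis .
qed

text \<open>The difference of \<open>harm n\<close> and \<open>ln n\<close> is decreasing and equals
  1 at n = 1.\<close>

lemma harm_le_ln: "n > 0 \<Longrightarrow> harm n \<le> 1 + ln (real n)"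
  using euler_mascheroni_sequence_decreasing[of 1 n] by (simp add: harm_def)

lemma sum_norm_sawtooth_transform_le:
  assumes "p > 1"
  shows "(\<Sum>h\<in>{1..<p}. norm (sawtooth_transform p h)) \<le> (real p)\<^sup>2 * (1 + ln (real p))"
proof -
  have "(\<Sum>h\<in>{1..<p}. norm (sawtooth_transform p h))
      \<le> (\<Sum>h\<in>{1..<p}. (real p)\<^sup>2 / 2 * (1 / real h + 1 / real (p - h)))"
    by (intro sum_mono norm_sawtooth_transform_le) auto
  also have "\<dots> = (real p)\<^sup>2 / 2 * ((\<Sum>h\<in>{1..<p}. 1 / real h) + (\<Sum>h\<in>{1..<p}. 1 / real (p - h)))"
    by (simp only: sum.distrib flip: sum_distrib_left)
  also have "(\<Sum>h\<in>{1..<p}. 1 / real (p - h)) = (\<Sum>h\<in>{1..<p}. 1 / real h)"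
    by (rule sum.reindex_bij_witness[where i = "\<lambda>h. p - h" and j = "\<lambda>h. p - h"]) auto
  also have "(\<Sum>h\<in>{1..<p}. 1 / real h) \<le> 1 + ln (real p)"
  proof -
    have "{1..<p} = {1..p - 1}" using assms by auto
    then have "(\<Sum>h\<in>{1..<p}. 1 / real h) = harm (p - 1)"
      by (simp add: harm_def inverse_eq_divide)
    also have "\<dots> \<le> 1 + ln (real (p - 1))" using assms by (intro harm_le_ln) auto
    also have "\<dots> \<le> 1 + ln (real p)" using assms by simp
    finally show ?thesis .
  qed
  then have "(real p)\<^sup>2 / 2 * ((\<Sum>h\<in>{1..<p}. 1 / real h) + (\<Sum>h\<in>{1..<p}. 1 / real h))
      \<le> (real p)\<^sup>2 / 2 * ((1 + ln (real p)) + (1 + ln (real p)))"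
    by (intro mult_left_mono add_mono) auto
  finally show ?thesis by (simp add: algebra_simps)
qed

text \<open>Fourier inversion; frequency 0 is left out because its coefficient vanishes.\<close>

lemma sawtooth_expansion:
  assumes "c < p"
  shows "of_nat p * of_real (sawtooth p c)
           = (\<Sum>h\<in>{1..<p}. sawtooth_transform p h * add_char p (int h * int c))"
proof -
  have p: "p > 0" using assms by simp
  have ortho: "(\<Sum>h<p. add_char p ((int c - int n) * int h)) = (if n = c then of_nat p else 0)"
    if "n < p" for n
  proof -
    have "int p dvd int c - int n \<longleftrightarrow> int c mod int p = int n mod int p"
      by (simp add: mod_eq_dvd_iff)
    also have "\<dots> \<longleftrightarrow> n = c" using that assms by auto
    finally show ?thesis using sum_add_char[OF p] by simp
  qed
  have "(\<Sum>h\<in>{1..<p}. sawtooth_transform p h * add_char p (int h * int c))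
      = (\<Sum>h<p. sawtooth_transform p h * add_char p (int h * int c))"
    by (rule sum.mono_neutral_left) (use sawtooth_transform_0[OF p] in \<open>auto simp: not_less_eq_eq\<close>)
  also have "\<dots> = (\<Sum>h<p. \<Sum>n<p. of_real (sawtooth p n) * add_char p ((int c - int n) * int h))"
    unfolding sawtooth_transform_def sum_distrib_right
  proof (intro sum.cong refl)
    fix h n
    have "(int c - int n) * int h = - int h * int n + int h * int c"
      by (simp add: algebra_simps)
    then show "of_real (sawtooth p n) * add_char p (- int h * int n) * add_char p (int h * int c)
        = of_real (sawtooth p n) * add_char p ((int c - int n) * int h)"
      by (simp only: add_char_add mult.assoc)
  qed
  also have "\<dots> = (\<Sum>n<p. of_real (sawtooth p n) * (\<Sum>h<p. add_char p ((int c - int n) * int h)))"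
    by (subst sum.swap) (simp add: sum_distrib_left)
  also have "\<dots> = (\<Sum>n<p. of_real (sawtooth p n) * (if n = c then of_nat p else 0))"
    by (intro sum.cong refl) (simp add: ortho)
  also have "\<dots> = of_nat p * of_real (sawtooth p c)"
    using assms by (simp add: if_distrib mult.commute cong: if_cong)
  finally show ?thesis by simp
qed

section \<open>Bilinear sums of sawtooth values\<close>

text \<open>Each frequency h gives a bilinear form with multiplier \<open>h * d\<close>, still prime
  to \<open>p\<close>, so one bound \<open>M\<close> serves all of them. The coefficients contribute
  p^2 (1 + ln p), and inversion divides by p.\<close>

lemma bilinear_sawtooth_sum_le:
  fixes u v :: "'a \<Rightarrow> real" and y :: "'a \<Rightarrow> nat"
  assumes "prime p" "\<not> int p dvd d" "finite B" "inj_on y B" "y ` B \<subseteq> {..<p}"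
  shows "\<bar>\<Sum>a\<in>B. \<Sum>b\<in>B. u a * v b * sawtooth p (nat (d * int (y a) * int (y b) mod int p))\<bar>
           \<le> real p * (1 + ln (real p)) * sqrt (real p)
               * sqrt (\<Sum>a\<in>B. (u a)\<^sup>2) * sqrt (\<Sum>b\<in>B. (v b)\<^sup>2)"
    (is "\<bar>?T\<bar> \<le> _")
proof -
  have p: "p > 1" "p > 0" using assms(1) prime_gt_1_nat prime_gt_0_nat by blast+
  define M where "M = sqrt (real p) * sqrt (\<Sum>a\<in>B. (u a)\<^sup>2) * sqrt (\<Sum>b\<in>B. (v b)\<^sup>2)"
  have M: "M \<ge> 0" by (simp add: M_def sum_nonneg)
  have expand: "of_nat p * of_real (sawtooth p (nat (d * int (y a) * int (y b) mod int p)))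
      = (\<Sum>h\<in>{1..<p}. sawtooth_transform p h * add_char p (int h * d * int (y a) * int (y b)))" for a b
  proof -
    define c where "c = nat (d * int (y a) * int (y b) mod int p)"
    have c: "int c = d * int (y a) * int (y b) mod int p" "c < p"
      using p by (auto simp: c_def nat_less_iff)
    \<comment> \<open>The character sees only residues, so the reduced residue \<open>c\<close> may
      be replaced by the full product; this separates \<open>y a\<close> and
      \<open>y b\<close>.\<close>
    have "add_char p (int h * int c) = add_char p (int h * d * int (y a) * int (y b))" for h
      by (subst (1 2) add_char_mod[OF p(2), symmetric]) (simp add: c(1) mod_mult_right_eq mult.assoc)
    with sawtooth_expansion[OF c(2)] show ?thesis unfolding c_def[symmetric] by simp
  qed
  have "of_nat p * complex_of_real ?T
      = (\<Sum>a\<in>B. \<Sum>b\<in>B. of_real (u a * v b)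
           * (of_nat p * of_real (sawtooth p (nat (d * int (y a) * int (y b) mod int p)))))"
    by (simp add: sum_distrib_left mult_ac)
  also have "\<dots> = (\<Sum>a\<in>B. \<Sum>b\<in>B. \<Sum>h\<in>{1..<p}. sawtooth_transform p h
           * (of_real (u a * v b) * add_char p (int h * d * int (y a) * int (y b))))"
    unfolding expand by (simp add: sum_distrib_left mult_ac)
  also have "\<dots> = (\<Sum>h\<in>{1..<p}. sawtooth_transform p h
           * (\<Sum>a\<in>B. \<Sum>b\<in>B. of_real (u a * v b) * add_char p (int h * d * int (y a) * int (y b))))"
    unfolding sum_distrib_left
    by (subst sum.swap[of _ B "{1..<p}"], rule sum.cong[OF refl], rule sum.swap)
  also have "norm \<dots> \<le> (\<Sum>h\<in>{1..<p}. norm (sawtooth_transform p h) * M)"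
  proof (rule sum_norm_le)
    fix h assume h: "h \<in> {1..<p}"
    then have "\<not> int p dvd int h" using p by (auto dest: zdvd_imp_le)
    then have "\<not> int p dvd int h * d" using assms(1,2) by (simp add: prime_dvd_mult_iff)
    from norm_bilinear_add_char_sum_le[OF assms(1) this assms(3-5)]
    show "norm (sawtooth_transform p h * (\<Sum>a\<in>B. \<Sum>b\<in>B. of_real (u a * v b)
            * add_char p (int h * d * int (y a) * int (y b)))) \<le> norm (sawtooth_transform p h) * M"
      unfolding M_def norm_mult by (intro mult_left_mono) auto
  qed
  also have "\<dots> = (\<Sum>h\<in>{1..<p}. norm (sawtooth_transform p h)) * M"
    by (simp add: sum_distrib_right)
  also have "\<dots> \<le> (real p)\<^sup>2 * (1 + ln (real p)) * M"
    by (intro mult_right_mono sum_norm_sawtooth_transform_le p M)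
  finally have "real p * \<bar>?T\<bar> \<le> real p * (real p * (1 + ln (real p)) * M)"
    by (simp only: norm_mult norm_of_real norm_of_nat power2_eq_square mult.assoc)
  then have "\<bar>?T\<bar> \<le> real p * (1 + ln (real p)) * M"
    using p by (simp only: mult_le_cancel_left_pos of_nat_0_less_iff)
  then show ?thesis by (simp add: M_def mult.assoc)
qed

section \<open>Eliminating the third variable\<close>

lemma exists_inverses_mod_prime:
  assumes "prime (p::nat)"
  obtains y where "\<And>a. a \<in> {1..p-1} \<Longrightarrow> y a < p"
    "\<And>a. a \<in> {1..p-1} \<Longrightarrow> [int a * int (y a) = 1] (mod int p)"
    "inj_on y {1..p-1}"
proof -
  have p: "p > 1" using assms prime_gt_1_nat by blast
  have "\<exists>x<p. [int a * int x = 1] (mod int p)" if a: "a \<in> {1..p-1}" for a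
  proof -
    have "\<not> p dvd a" using a by (auto dest: dvd_imp_le)
    then have "coprime a p"
      using assms by (metis coprime_commute prime_imp_coprime)
    then obtain x where "[a * x = 1] (mod p)" using cong_solve_coprime_nat by auto
    then have "[a * (x mod p) = 1] (mod p)" by (simp add: cong_def mod_mult_right_eq)
    then show ?thesis using p by (intro exI[of _ "x mod p"]) (auto simp flip: cong_int_iff)
  qed
  then obtain y where y: "\<And>a. a \<in> {1..p-1} \<Longrightarrow> y a < p"
    "\<And>a. a \<in> {1..p-1} \<Longrightarrow> [int a * int (y a) = 1] (mod int p)"
    by metis
  moreover have "inj_on y {1..p-1}"
  proof (rule inj_onI)
    fix a b assume a: "a \<in> {1..p-1}" and b: "b \<in> {1..p-1}" and eq: "y a = y b"
    \<comment> \<open>Multiplying a, b and their common inverse in two ways gives both a and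
      b.\<close>
    have "[int a * (int b * int (y b)) = int a * 1] (mod int p)"
      using y(2)[OF b] by (rule cong_scalar_left)
    moreover have "[int b * (int a * int (y a)) = int b * 1] (mod int p)"
      using y(2)[OF a] by (rule cong_scalar_left)
    ultimately have "[int a = int b] (mod int p)"
      using eq by (auto simp: mult_ac cong_def)
    then have "[a = b] (mod p)" by (simp add: cong_int_iff)
    then show "a = b" using a b by (auto simp: cong_def)
  qed
  ultimately show ?thesis using that by blast
qed

text \<open>Each pair (a, b) completes to exactly one admissible triple. The positivity claim is
  kept because the sawtooth function treats the residue 0 separately.\<close>

lemma S3_eq_double_sum:
  assumes "prime p" "\<not> int p dvd d"
    and y: "\<And>a. a \<in> {1..p-1} \<Longrightarrow> [int a * int (y a) = 1] (mod int p)"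
  shows "S3 p d = (\<Sum>a\<in>{1..p-1}. \<Sum>b\<in>{1..p-1}. a * b * nat (d * int (y a) * int (y b) mod int p))"
    and "\<And>a b. a \<in> {1..p-1} \<Longrightarrow> b \<in> {1..p-1} \<Longrightarrow> nat (d * int (y a) * int (y b) mod int p) > 0"
proof -
  have p: "p > 1" using assms prime_gt_1_nat by blast
  define c where "c a b = nat (d * int (y a) * int (y b) mod int p)" for a b
  have c: "int (c a b) = d * int (y a) * int (y b) mod int p" for a b
    using p by (simp add: c_def)
  have c_less: "c a b < p" for a b using p by (simp add: c_def nat_less_iff)
  have c_cong: "[int (a * b * c a b) = d] (mod int p)" if "a \<in> {1..p-1}" "b \<in> {1..p-1}" for a b
  proof -
    have "[int (a * b * c a b) = int a * int b * (d * int (y a) * int (y b))] (mod int p)"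
      by (simp add: c cong_def mod_mult_right_eq)
    also have "int a * int b * (d * int (y a) * int (y b)) = d * ((int a * int (y a)) * (int b * int (y b)))"
      by (simp add: mult_ac)
    also have "[\<dots> = d * (1 * 1)] (mod int p)"
      using that by (intro cong_mult y cong_refl)
    finally show ?thesis by simp
  qed
  \<comment> \<open>A zero residue would make the product 0 and force \<open>p\<close> to divide
    \<open>d\<close>.\<close>
  have c_pos: "c a b > 0" if "a \<in> {1..p-1}" "b \<in> {1..p-1}" for a b
    using c_cong[OF that] assms(2) by (cases "c a b = 0") (auto simp: cong_def dvd_eq_mod_eq_0)
  then show "\<And>a b. a \<in> {1..p-1} \<Longrightarrow> b \<in> {1..p-1} \<Longrightarrow> nat (d * int (y a) * int (y b) mod int p) > 0"
    by (simp add: c_def)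
  have c_unique: "z = c a b"
    if "a \<in> {1..p-1}" "b \<in> {1..p-1}" "z \<in> {1..p-1}" "[int (a * b * z) = d] (mod int p)" for a b z
  proof -
    have "[int (a * b * z) = int (a * b * c a b)] (mod int p)"
      using that(4) c_cong[OF that(1,2)] cong_sym cong_trans by blast
    then have "[a * b * z = a * b * c a b] (mod p)" by (simp only: cong_int_iff)
    moreover have "\<not> p dvd a" "\<not> p dvd b" using that by (auto dest: dvd_imp_le)
    then have "coprime (a * b) p"
      using assms(1) by (simp add: coprime_commute[of _ p] prime_imp_coprime)
    ultimately have "[z = c a b] (mod p)" using cong_mult_lcancel_nat by blast
    then show ?thesis using that(3) c_less[of a b] by (auto simp: cong_def)
  qed
  have "S3 p d = (\<Sum>(a, b)\<in>{1..p-1} \<times> {1..p-1}. a * b * c a b)"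
    unfolding S3_def
  proof (rule sum.reindex_bij_witness[where i = "\<lambda>(a, b). (a, b, c a b)" and j = "\<lambda>(a, b, z). (a, b)"],
      goal_cases)
    \<comment> \<open>Case 1 is uniqueness of the third entry, case 4 that the completed pair is an
      admissible triple, and case 5 that the summands agree.\<close>
    case (1 t)
    then show ?case using c_unique by auto
  next
    case (4 t)
    then obtain a b where t: "t = (a, b)" "a \<in> {1..p-1}" "b \<in> {1..p-1}" by auto
    then have "c a b \<in> {1..p-1}" using c_pos[of a b] c_less[of a b] by auto
    then show ?case using t c_cong by auto
  next
    case (5 t)
    then show ?case using c_unique by auto
  qed auto
  then show "S3 p d = (\<Sum>a\<in>{1..p-1}. \<Sum>b\<in>{1..p-1}. a * b * nat (d * int (y a) * int (y b) mod int p))"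
    by (simp add: sum.cartesian_product c_def)
qed

section \<open>The asymptotic formula\<close>

text \<open>The constant p/2 in place of the third variable yields the main term. The rest is the
  bilinear sawtooth sum with both weights the identity, whose square norms multiply to a sum of
  squares of size at most p^3.\<close>

lemma S3_minus_main_term_le:
  assumes "prime p" "\<not> int p dvd d"
  shows "\<bar>real (S3 p d) - real p ^ 3 * (real p - 1)\<^sup>2 / 8\<bar>
           \<le> real p ^ 4 * sqrt (real p) * (1 + ln (real p))"
proof -
  have p: "p > 1" using assms prime_gt_1_nat by blast
  define N where "N = {1..p-1}"
  obtain y where y: "\<And>a. a \<in> N \<Longrightarrow> y a < p"
    "\<And>a. a \<in> N \<Longrightarrow> [int a * int (y a) = 1] (mod int p)" "inj_on y N"
    using exists_inverses_mod_prime[OF assms(1)] unfolding N_def by metis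
  note S3 = S3_eq_double_sum[OF assms, of y, folded N_def, OF y(2)]
  define c where "c a b = nat (d * int (y a) * int (y b) mod int p)" for a b
  define T where "T = (\<Sum>a\<in>N. \<Sum>b\<in>N. real a * real b * sawtooth p (c a b))"
  have sumN: "(\<Sum>a\<in>N. real a) = real p * (real p - 1) / 2"
  proof -
    have "(\<Sum>a\<in>N. real a) = (\<Sum>a<p. real a)"
      by (rule sum.mono_neutral_left) (use p in \<open>auto simp: N_def\<close>)
    then show ?thesis by (simp add: sum_real_lessThan)
  qed
  have sumN2: "(\<Sum>a\<in>N. (real a)\<^sup>2) \<le> real p ^ 3"
  proof -
    have "(\<Sum>a\<in>N. (real a)\<^sup>2) \<le> (\<Sum>a\<in>N. (real p)\<^sup>2)"
      by (intro sum_mono power_mono) (auto simp: N_def)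
    also have "\<dots> = real (p - 1) * (real p)\<^sup>2" by (simp add: N_def)
    also have "\<dots> \<le> real p * (real p)\<^sup>2" by (intro mult_right_mono) auto
    finally show ?thesis by (simp add: power2_eq_square power3_eq_cube)
  qed
  have "real (S3 p d) = (\<Sum>a\<in>N. \<Sum>b\<in>N. real a * real b * real (c a b))"
    by (simp add: S3(1) c_def)
  also have "\<dots> = (\<Sum>a\<in>N. \<Sum>b\<in>N. real p / 2 * (real a * real b) + real a * real b * sawtooth p (c a b))"
  proof (intro sum.cong refl)
    fix a b assume "a \<in> N" "b \<in> N"
    \<comment> \<open>This excludes the exceptional value of the sawtooth function.\<close>
    then have "c a b \<noteq> 0" using S3(2) unfolding c_def by blast
    then show "real a * real b * real (c a b)
        = real p / 2 * (real a * real b) + real a * real b * sawtooth p (c a b)"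
      by (simp add: sawtooth_def algebra_simps)
  qed
  also have "\<dots> = real p / 2 * ((\<Sum>a\<in>N. real a) * (\<Sum>b\<in>N. real b)) + T"
    unfolding T_def sum.distrib sum_product by (simp only: sum_distrib_left)
  also have "\<dots> = real p ^ 3 * (real p - 1)\<^sup>2 / 8 + T"
    by (simp add: sumN power2_eq_square power3_eq_cube)
  finally have "\<bar>real (S3 p d) - real p ^ 3 * (real p - 1)\<^sup>2 / 8\<bar> = \<bar>T\<bar>" by simp
  also have "\<dots> \<le> real p * (1 + ln (real p)) * sqrt (real p)
      * sqrt (\<Sum>a\<in>N. (real a)\<^sup>2) * sqrt (\<Sum>b\<in>N. (real b)\<^sup>2)"
    unfolding T_def c_def using y by (intro bilinear_sawtooth_sum_le assms) (auto simp: N_def)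
  also have "\<dots> = real p * (1 + ln (real p)) * sqrt (real p) * (\<Sum>a\<in>N. (real a)\<^sup>2)"
    by (simp add: mult.assoc sum_nonneg)
  also have "\<dots> \<le> real p * (1 + ln (real p)) * sqrt (real p) * real p ^ 3"
    using p by (intro mult_left_mono sumN2 mult_nonneg_nonneg add_nonneg_nonneg) auto
  finally show ?thesis by (simp add: power_numeral_reduce mult_ac)
qed

theorem theorem4:
  "\<exists>C::real. C > 0 \<and> (\<forall>(p::nat) (d::int). prime p \<longrightarrow> coprime d (int p) \<longrightarrow>
     \<bar>real (S3 p d) - real p ^ 5 / 8\<bar> \<le> C * (real p powr (9/2) * (ln (real p))\<^sup>2))"
\<comment> \<open>The error found is at most P (2 + L) with L = ln p >= 1/2. Then L^2 >= L/2, so 10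
  L^2 >= 5 L >= 2 + L, which explains the witness 10.\<close>
proof (intro exI[of _ "10::real"] conjI allI impI)
  fix p :: nat and d :: int
  assume prime: "prime p" and "coprime d (int p)"
  have p: "p \<ge> 2" using prime prime_ge_2_nat by blast
  have "\<not> int p dvd d"
  proof
    assume "int p dvd d"
    then have "is_unit (int p)" using \<open>coprime d (int p)\<close> by (meson coprime_common_divisor dvd_refl)
    then show False using p by simp
  qed
  note main = S3_minus_main_term_le[OF prime this]
  define P where "P = real p ^ 4 * sqrt (real p)"
  define L where "L = ln (real p)"
  have P: "real p powr (9/2) = P"
  proof -
    have "real p powr (9/2) = real p powr (real 4 + 1/2)" by simp
    also have "\<dots> = real p powr real 4 * real p powr (1/2)" by (rule powr_add)
    finally show ?thesis using p by (simp add: P_def powr_half_sqrt powr_realpow)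
  qed
  have "real p ^ 4 * 1 \<le> P" unfolding P_def using p by (intro mult_left_mono) auto
  \<comment> \<open>Replacing (p - 1)^2 by p^2 in the main term costs p^3 (2 p - 1) / 8, below the
    error size \<open>P\<close>.\<close>
  moreover have "\<bar>real p ^ 3 * (real p - 1)\<^sup>2 / 8 - real p ^ 5 / 8\<bar> \<le> real p ^ 4"
  proof -
    have "real p ^ 3 * (real p - 1)\<^sup>2 / 8 - real p ^ 5 / 8 = - (real p ^ 3 * (2 * real p - 1) / 8)"
      by (simp add: power2_eq_square field_simps power_numeral_reduce)
    moreover have "real p ^ 3 * (2 * real p - 1) \<le> real p ^ 3 * (8 * real p)"
      using p by (intro mult_left_mono) auto
    moreover have "real p ^ 3 * (2 * real p - 1) \<ge> 0" using p by simp
    ultimately show ?thesis by (simp add: power_numeral_reduce)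
  qed
  ultimately have "\<bar>real (S3 p d) - real p ^ 5 / 8\<bar> \<le> P * (1 + L) + P"
    using main by (simp add: P_def L_def)
  also have "\<dots> = P * (2 + L)" by (simp add: algebra_simps)
  also have "\<dots> \<le> P * (10 * L\<^sup>2)"
  proof (intro mult_left_mono)
    have "1 / 2 \<le> ln (2::real)" using ln_le_minus_one[of "1/2 :: real"] by (simp add: ln_div)
    also have "\<dots> \<le> L" unfolding L_def using p by simp
    finally have L: "1 / 2 \<le> L" .
    then have "1 / 2 * L \<le> L * L" by (intro mult_right_mono) auto
    then show "2 + L \<le> 10 * L\<^sup>2" using L unfolding power2_eq_square by linarith
  qed (simp add: P_def)
  finally show "\<bar>real (S3 p d) - real p ^ 5 / 8\<bar> \<le> 10 * (real p powr (9/2) * (ln (real p))\<^sup>2)"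
    by (simp add: P L_def)
qed simp

end
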